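(* Let $\mathbb X$ be a separable infinite-dimensional Banach space over $\mathbb F=\mathbb R$ or $\mathbb C$ with a semi-normalized Markushevich basis $\mathcal B=(\mathbf e_i)_{i\in\mathbb N}$. Let $0<s\le 1$ and let $\mathbf n=(n_i)_{i\in\mathbb N}$ be a strictly increasing sequence of natural numbers. If $\mathcal B$ is $\mathbf C_{q,s}$-$\mathbf n$-$s$-quasi-greedy, then for each $t$ with $$s\left(1-\frac{1}{\mathbf C_{q,s}}\right)<t<s,$$ $\mathcal B$ is $\mathbf n$-$t$-quasi-greedy, with constant $$\mathbf C_{q,t}\le \frac{\mathbf C_{q,s}\,t}{s-\mathbf C_{q,s}(s-t)}.$$
   Context: A semi-normalized Markushevich basis of $\mathbb X$ is a sequence $(\mathbf e_i)_{i\in\mathbb N}\subset\mathbb X$ with dense linear span, for which there is a (unique) sequence of biorthogonal functionals $(\mathbf e_i^* )_{i\in\mathbb N}\subset\mathbb X^*$ with $\mathbf e_k^*(\mathbf e_i)=\delta_{k,i}$, such that $\mathbf e_i^*(x)=0$ for all $i$ implies $x=0$, and $\sup_i\{\|\mathbf e_i\|,\|\mathbf e_i^*\|\}<\infty$. For a finite set $A\subset\mathbb N$, $P_A(x)=\sum_{i\in A}\mathbf e_i^*(x)\mathbf e_i$. For $0<t\le1$, a finite set $A\subset\mathbb N$ is a $t$-greedy set for $x\in\mathbb X$ if $\min_{i\in A}|\mathbf e_i^*(x)|\ge t\max_{i\notin A}|\mathbf e_i^*(x)|$, i.e. $|\mathbf e_i^*(x)|\ge t|\mathbf e_j^*(x)|$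 for all $i\in A$, $j\notin A$. For $0<t\le 1$, $\mathcal B$ is $\mathbf n$-$t$-quasi-greedy if there is $C>0$ such that $\|P_A(x)\|\le C\|x\|$ for all $x\in\mathbb X$ and all $t$-greedy sets $A$ for $x$ with $|A|\in\mathbf n$ (that is, $|A|=n_k$ for some $k$). The smallest such constant is denoted $\mathbf C_{q,t}$, and $\mathcal B$ is then called $\mathbf C_{q,t}$-$\mathbf n$-$t$-quasi-greedy. *)

theory Defs
  imports "HOL-Analysis.Analysis"
begin

(* Banach space 'a over the scalar field 'f.  The class real_normed_field has a multiplicative norm,
   so by the Gelfand-Mazur theorem its instances are, up to isometric isomorphism, exactly the reals
   and the complex numbers.  Completeness is part of the class banach; scl_of_real says that the
   F-vector space structure extends the real one carried by that class. *)
locale banach_over = vector_space scl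
  for scl :: "'f::real_normed_field \<Rightarrow> 'a::banach \<Rightarrow> 'a" +
  assumes scl_of_real: "scl (of_real r) x = r *\<^sub>R x"
    and norm_scl: "norm (scl c x) = norm c * norm x"

definition separable_type :: "'a::topological_space itself \<Rightarrow> bool" where
  "separable_type _ \<longleftrightarrow> (\<exists>D :: 'a set. countable D \<and> closure D = UNIV)"

definition infinite_dimensional :: "('f::field \<Rightarrow> 'a::ab_group_add \<Rightarrow> 'a) \<Rightarrow> bool" where
  "infinite_dimensional scl \<longleftrightarrow> \<not> (\<exists>B. finite B \<and> module.span scl B = UNIV)"

definition continuous_functional ::
    "('f::real_normed_field \<Rightarrow> 'a::real_normed_vector \<Rightarrow> 'a) \<Rightarrow> ('a \<Rightarrow> 'f) \<Rightarrow> bool" where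
  "continuous_functional scl f \<longleftrightarrow> bounded_linear f \<and> (\<forall>c x. f (scl c x) = c * f x)"

(* es is the sequence of biorthogonal functionals of e; it is determined by e, as the span of e
   is dense, and is carried along as a parameter. *)
definition semi_normalized_Markushevich_basis ::
    "('f::real_normed_field \<Rightarrow> 'a::real_normed_vector \<Rightarrow> 'a) \<Rightarrow> (nat \<Rightarrow> 'a) \<Rightarrow> (nat \<Rightarrow> 'a \<Rightarrow> 'f) \<Rightarrow> bool"
  where
  "semi_normalized_Markushevich_basis scl e es \<longleftrightarrow>
     closure (module.span scl (range e)) = UNIV \<and>
     (\<forall>k. continuous_functional scl (es k)) \<and>
     (\<forall>k i. es k (e i) = (if k = i then 1 else 0)) \<and>
     (\<forall>x. (\<forall>i. es i x = 0) \<longrightarrow> x = 0) \<and>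
     (\<exists>M. \<forall>i. norm (e i) \<le> M \<and> onorm (es i) \<le> M)"

definition projection ::
    "('f \<Rightarrow> 'a::comm_monoid_add \<Rightarrow> 'a) \<Rightarrow> (nat \<Rightarrow> 'a) \<Rightarrow> (nat \<Rightarrow> 'a \<Rightarrow> 'f) \<Rightarrow> nat set \<Rightarrow> 'a \<Rightarrow> 'a" where
  "projection scl e es A x = (\<Sum>i\<in>A. scl (es i x) (e i))"

definition greedy_set ::
    "(nat \<Rightarrow> 'a \<Rightarrow> 'f::real_normed_vector) \<Rightarrow> real \<Rightarrow> 'a \<Rightarrow> nat set \<Rightarrow> bool" where
  "greedy_set es t x A \<longleftrightarrow>
     finite A \<and> (\<forall>i\<in>A. \<forall>j. j \<notin> A \<longrightarrow> norm (es i x) \<ge> t * norm (es j x))"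

definition quasi_greedy_bound ::
    "('f::real_normed_field \<Rightarrow> 'a::real_normed_vector \<Rightarrow> 'a) \<Rightarrow> (nat \<Rightarrow> 'a) \<Rightarrow> (nat \<Rightarrow> 'a \<Rightarrow> 'f)
      \<Rightarrow> (nat \<Rightarrow> nat) \<Rightarrow> real \<Rightarrow> real \<Rightarrow> bool" where
  "quasi_greedy_bound scl e es n t C \<longleftrightarrow>
     C > 0 \<and>
     (\<forall>x A. greedy_set es t x A \<and> card A \<in> range n \<longrightarrow> norm (projection scl e es A x) \<le> C * norm x)"

definition quasi_greedy ::
    "('f::real_normed_field \<Rightarrow> 'a::real_normed_vector \<Rightarrow> 'a) \<Rightarrow> (nat \<Rightarrow> 'a) \<Rightarrow> (nat \<Rightarrow> 'a \<Rightarrow> 'f)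
      \<Rightarrow> (nat \<Rightarrow> nat) \<Rightarrow> real \<Rightarrow> bool" where
  "quasi_greedy scl e es n t \<longleftrightarrow> (\<exists>C. quasi_greedy_bound scl e es n t C)"

(* The least admissible constant.  For a quasi-greedy basis and strictly increasing n the set is
   nonempty, closed and bounded below by 1, so the infimum is attained. *)
definition quasi_greedy_const ::
    "('f::real_normed_field \<Rightarrow> 'a::real_normed_vector \<Rightarrow> 'a) \<Rightarrow> (nat \<Rightarrow> 'a) \<Rightarrow> (nat \<Rightarrow> 'a \<Rightarrow> 'f)
      \<Rightarrow> (nat \<Rightarrow> nat) \<Rightarrow> real \<Rightarrow> real" where
  "quasi_greedy_const scl e es n t = Inf {C. quasi_greedy_bound scl e es n t C}"

end

theory Submission
  imports Defs
begin

text \<open>If \<open>A\<close> is \<open>t\<close>-greedy for \<open>x\<close>, then it is \<open>s\<close>-greedy for \<open>y = x + (s/t - 1) P\<^sub>A x\<close>, whose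
  coefficients on \<open>A\<close> are those of \<open>x\<close> multiplied by \<open>s/t\<close>. Hence
  \<open>(s/t) \<parallel>P\<^sub>A x\<parallel> = \<parallel>P\<^sub>A y\<parallel> \<le> C \<parallel>x\<parallel> + C (s/t - 1) \<parallel>P\<^sub>A x\<parallel>\<close>, and one solves for \<open>\<parallel>P\<^sub>A x\<parallel>\<close>.\<close>

lemma coeff_projection:
  assumes M: "semi_normalized_Markushevich_basis scl e es" and "finite A"
  shows "es k (projection scl e es A x) = (if k \<in> A then es k x else 0)"
proof -
  have bl: "bounded_linear (es k)" and hom: "\<And>c x. es k (scl c x) = c * es k x"
    and bi: "\<And>i. es k (e i) = (if k = i then 1 else 0)"
    using M unfolding semi_normalized_Markushevich_basis_def continuous_functional_def by auto
  have "es k (projection scl e es A x) = (\<Sum>i\<in>A. es i x * (if k = i then 1 else 0))"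
    unfolding projection_def
    by (simp add: linear_sum[OF bounded_linear.linear[OF bl]] hom bi)
  also have "\<dots> = (\<Sum>i\<in>A. if k = i then es i x else 0)"
    by (intro sum.cong) auto
  also have "\<dots> = (if k \<in> A then es k x else 0)"
    using \<open>finite A\<close> by simp
  finally show ?thesis .
qed

lemma coeff_dilate:
  assumes M: "semi_normalized_Markushevich_basis scl e es" and "finite A"
  shows "es k (x + (r - 1) *\<^sub>R projection scl e es A x) = (if k \<in> A then r *\<^sub>R es k x else es k x)"
proof -
  have "linear (es k)"
    using M bounded_linear.linear
    unfolding semi_normalized_Markushevich_basis_def continuous_functional_def by blast
  then show ?thesis
    by (simp add: linear_add linear_scale coeff_projection[OF assms]) (simp add: algebra_simps)
qed

lemma projection_dilate:
  assumes B: "banach_over scl"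
    and M: "semi_normalized_Markushevich_basis scl e es" and "finite A"
  shows "projection scl e es A (x + (r - 1) *\<^sub>R projection scl e es A x)
    = r *\<^sub>R projection scl e es A x"
proof -
  interpret banach_over scl by fact
  \<comment> \<open>The dilation is by a real scalar while coefficients live in \<open>'f\<close>;
    \<open>scl_of_real\<close> makes the two scalings compatible, so the factor \<open>r\<close> can
    leave the sum.\<close>
  have "scl (r *\<^sub>R c) v = r *\<^sub>R scl c v" for c v
    by (metis scl_of_real scale_scale scaleR_conv_of_real)
  then show ?thesis
    unfolding projection_def[of scl e es A "x + _"]
    by (simp add: coeff_dilate[OF M \<open>finite A\<close>]) (simp add: scaleR_sum_right projection_def)
qed

text \<open>Multiplying the \<open>t\<close>-greedy inequality by \<open>s / t\<close> replaces its
  factor \<open>t\<close> by \<open>s\<close>. This is the inequality needed, since the dilation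
  enlarges coefficients on \<open>A\<close> by \<open>s / t\<close> and leaves the others
  alone.\<close>

lemma greedy_set_dilate:
  assumes M: "semi_normalized_Markushevich_basis scl e es"
    and "0 < t" "0 \<le> s" and G: "greedy_set es t x A"
  shows "greedy_set es s (x + (s / t - 1) *\<^sub>R projection scl e es A x) A"
proof -
  have fin: "finite A" using G by (simp add: greedy_set_def)
  have "s * norm (es j x) \<le> (s / t) * norm (es i x)" if "i \<in> A" "j \<notin> A" for i j
  proof -
    have "t * norm (es j x) \<le> norm (es i x)"
      using G that by (simp add: greedy_set_def)
    then have "(s / t) * (t * norm (es j x)) \<le> (s / t) * norm (es i x)"
      using \<open>0 < t\<close> \<open>0 \<le> s\<close> by (intro mult_left_mono) auto
    then show ?thesis using \<open>0 < t\<close> by simp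
  qed
  then show ?thesis
    using fin \<open>0 < t\<close> \<open>0 \<le> s\<close> by (simp add: greedy_set_def coeff_dilate[OF M fin])
qed

text \<open>The infimum is attained: for \<open>x\<close> nonzero, every admissible constant
  dominates the fixed ratio of norms, hence so does their greatest lower bound. Positivity is
  assumed because admissibility includes \<open>C > 0\<close>, a condition that need not survive an
  infimum.\<close>

lemma quasi_greedy_bound_const:
  assumes "quasi_greedy scl e es n s" "0 < quasi_greedy_const scl e es n s"
  shows "quasi_greedy_bound scl e es n s (quasi_greedy_const scl e es n s)"
proof -
  have ne: "{C. quasi_greedy_bound scl e es n s C} \<noteq> {}"
    using assms by (auto simp: quasi_greedy_def)
  have "norm (projection scl e es A x) \<le> quasi_greedy_const scl e es n s * norm x"
    if "greedy_set es s x A" "card A \<in> range n" for x A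
  proof (cases "norm x = 0")
    \<comment> \<open>No ratio is available here, but any single admissible constant already forces
      the projection to vanish.\<close>
    case True
    with ne that show ?thesis by (fastforce simp: quasi_greedy_bound_def)
  next
    case False
    then have "norm (projection scl e es A x) / norm x \<le> C"
      if "quasi_greedy_bound scl e es n s C" for C
      using that \<open>greedy_set es s x A\<close> \<open>card A \<in> range n\<close>
      by (auto simp: quasi_greedy_bound_def divide_le_eq)
    then have "norm (projection scl e es A x) / norm x \<le> quasi_greedy_const scl e es n s"
      unfolding quasi_greedy_const_def using ne by (intro cInf_greatest) auto
    then show ?thesis using False by (simp add: divide_le_eq)
  qed
  with assms show ?thesis by (simp add: quasi_greedy_bound_def)
qed

lemma quasi_greedy_const_le:
  assumes "quasi_greedy_bound scl e es n t C"
  shows "quasi_greedy_const scl e es n t \<le> C"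
  unfolding quasi_greedy_const_def
  by (rule cInf_lower) (use assms in \<open>auto simp: bdd_below_def quasi_greedy_bound_def intro: less_imp_le\<close>)

text \<open>Tested on \<open>e 0\<close> with the initial segment of length \<open>n 1 > 0\<close>: its coefficients vanish outside
  that segment, so the segment is a greedy set.\<close>
lemma one_le_quasi_greedy_bound:
  assumes B: "banach_over scl"
    and M: "semi_normalized_Markushevich_basis scl e es"
    and "strict_mono n" and Q: "quasi_greedy_bound scl e es n s C"
  shows "1 \<le> C"
proof -
  interpret banach_over scl by fact
  have bi: "\<And>k i. es k (e i) = (if k = i then 1 else 0)"
    and lin: "linear (es 0)"
    using M bounded_linear.linear
    unfolding semi_normalized_Markushevich_basis_def continuous_functional_def by blast+
  \<comment> \<open>\<open>n 0\<close> may be 0, which would give the empty set and no information;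
    \<open>n 1\<close> is certainly positive.\<close>
  have "n 0 < n 1" using \<open>strict_mono n\<close> by (simp add: strict_mono_def)
  then have "projection scl e es {..<n 1} (e 0) = (\<Sum>i<n 1. if i = 0 then e i else 0)"
    unfolding projection_def by (intro sum.cong) (auto simp: bi)
  also have "\<dots> = e 0" using \<open>n 0 < n 1\<close> by simp
  finally have P: "projection scl e es {..<n 1} (e 0) = e 0" .
  have "greedy_set es s (e 0) {..<n 1}"
    using \<open>n 0 < n 1\<close> by (auto simp: greedy_set_def bi)
  then have "norm (e 0) \<le> C * norm (e 0)"
    using Q P by (fastforce simp: quasi_greedy_bound_def)
  \<comment> \<open>A zero vector would contradict \<open>es 0 (e 0) = 1\<close>, so the norm can be
    cancelled.\<close>
  moreover have "e 0 \<noteq> 0"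
    using bi[of 0 0] linear_0[OF lin] by auto
  ultimately show ?thesis by simp
qed

lemma one_le_quasi_greedy_const:
  assumes "banach_over scl" "semi_normalized_Markushevich_basis scl e es"
    and "strict_mono n" "quasi_greedy scl e es n s"
  shows "1 \<le> quasi_greedy_const scl e es n s"
  unfolding quasi_greedy_const_def
  using assms one_le_quasi_greedy_bound[OF assms(1-3)]
  by (intro cInf_greatest) (auto simp: quasi_greedy_def)

text \<open>This holds for any admissible \<open>C\<close>, not only the least one. The hypothesis
  \<open>pos\<close> is what allows the multiple of the projection's norm on the right to be
  absorbed into the left side.\<close>

lemma quasi_greedy_bound_weaken:
  assumes B: "banach_over scl"
    and M: "semi_normalized_Markushevich_basis scl e es"
    and "0 < t" "t \<le> s" and Q: "quasi_greedy_bound scl e es n s C"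
    and pos: "0 < s - C * (s - t)"
  shows "quasi_greedy_bound scl e es n t (C * t / (s - C * (s - t)))"
proof -
  have "0 < C" using Q by (simp add: quasi_greedy_bound_def)
  have "norm (projection scl e es A x) \<le> C * t / (s - C * (s - t)) * norm x"
    if G: "greedy_set es t x A" and "card A \<in> range n" for x A
  proof -
    have fin: "finite A" using G by (simp add: greedy_set_def)
    define p where "p = norm (projection scl e es A x)"
    let ?y = "x + (s / t - 1) *\<^sub>R projection scl e es A x"
    have "0 \<le> s / t - 1" using \<open>0 < t\<close> \<open>t \<le> s\<close> by simp
    have "greedy_set es s ?y A"
      using greedy_set_dilate[OF M \<open>0 < t\<close> _ G] \<open>0 < t\<close> \<open>t \<le> s\<close> by simp
    then have "norm (projection scl e es A ?y) \<le> C * norm ?y"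
      using Q \<open>card A \<in> range n\<close> by (simp add: quasi_greedy_bound_def)
    then have "s / t * p \<le> C * norm ?y"
      using \<open>0 < t\<close> \<open>t \<le> s\<close> by (simp add: projection_dilate[OF B M fin] p_def)
    also have "\<dots> \<le> C * (norm x + (s / t - 1) * p)"
      using \<open>0 < C\<close> \<open>0 \<le> s / t - 1\<close> norm_triangle_ineq[of x "(s / t - 1) *\<^sub>R projection scl e es A x"]
      by (simp add: p_def)
    finally have "t * (s / t * p) \<le> t * (C * (norm x + (s / t - 1) * p))"
      using \<open>0 < t\<close> by (intro mult_left_mono) auto
    moreover have "t * (s / t * p) = s * p"
      and "t * (C * (norm x + (s / t - 1) * p)) = C * t * norm x + C * (s - t) * p"
      using \<open>0 < t\<close> by (simp_all add: field_simps)
    ultimately have "p * (s - C * (s - t)) \<le> C * t * norm x"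
      by (simp add: algebra_simps)
    then show ?thesis
      using pos by (simp add: p_def pos_le_divide_eq)
  qed
  with \<open>0 < C\<close> \<open>0 < t\<close> pos show ?thesis by (simp add: quasi_greedy_bound_def)
qed

theorem lemma3p7:
  fixes scl :: "'f::real_normed_field \<Rightarrow> 'a::banach \<Rightarrow> 'a"
    and e :: "nat \<Rightarrow> 'a" and es :: "nat \<Rightarrow> 'a \<Rightarrow> 'f"
    and n :: "nat \<Rightarrow> nat" and s :: real
  assumes "banach_over scl"
    and "separable_type TYPE('a)"
    and "infinite_dimensional scl"
    and "semi_normalized_Markushevich_basis scl e es"
    and "0 < s" and "s \<le> 1"
    and "strict_mono n"
    and "quasi_greedy scl e es n s"
  shows "\<forall>t. s * (1 - 1 / quasi_greedy_const scl e es n s) < t \<and> t < s \<longrightarrow>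
           quasi_greedy scl e es n t \<and>
           quasi_greedy_const scl e es n t \<le>
             quasi_greedy_const scl e es n s * t / (s - quasi_greedy_const scl e es n s * (s - t))"
proof (intro allI impI)
  fix t
  let ?C = "quasi_greedy_const scl e es n s"
  assume t: "s * (1 - 1 / ?C) < t \<and> t < s"
  have "1 \<le> ?C" using assms by (intro one_le_quasi_greedy_const)
  \<comment> \<open>The lower end of the interval for \<open>t\<close> is nonnegative because the
    constant is at least 1; this is where \<open>0 < t\<close> comes from.\<close>
  have "0 \<le> s * (1 - 1 / ?C)" using \<open>1 \<le> ?C\<close> \<open>0 < s\<close> by simp
  with t have "0 < t" by linarith
  \<comment> \<open>Multiplied by \<open>?C\<close>, the lower bound on \<open>t\<close> says
    exactly that the denominator is positive.\<close>
  have "0 < s - ?C * (s - t)" using t \<open>1 \<le> ?C\<close> by (simp add: field_simps)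
  moreover have "quasi_greedy_bound scl e es n s ?C"
    using assms \<open>1 \<le> ?C\<close> by (intro quasi_greedy_bound_const) auto
  ultimately have "quasi_greedy_bound scl e es n t (?C * t / (s - ?C * (s - t)))"
    using quasi_greedy_bound_weaken assms t \<open>0 < t\<close> by (metis less_imp_le)
  \<comment> \<open>The one admissible constant at \<open>t\<close> both witnesses quasi-greediness
    and bounds the infimum from above.\<close>
  then show "quasi_greedy scl e es n t \<and>
      quasi_greedy_const scl e es n t \<le> ?C * t / (s - ?C * (s - t))"
    using quasi_greedy_const_le by (auto simp: quasi_greedy_def)
qed

end
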